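(* In the secretary problem with values in $[0,1]$, for every measurable threshold function $f:[0,1]\to[0,1]$, the pricing curve with threshold $f$ (which picks the first arriving value $x_i$ with $x_i\ge f(t_i)$, obtaining $0$ if none) has worst-case regret at least $1/4$, i.e. $\sup_{\vec x}\big(x_1-\mathbb{E}[\mathsf{Alg}(\vec x)]\big)\ge 1/4$.
   Context: Secretary problem: an adversary fixes $n$ values $1\ge x_1\ge x_2\ge\dots\ge x_n\ge 0$. Each value $x_i$ arrives at a time $t_i$, where $t_1,\dots,t_n$ are independent and uniform on $[0,1]$. An online algorithm observes the values in increasing order of arrival time and must irrevocably decide upon each arrival whether to pick it; it may pick at most one value, and if it picks none it obtains $0$. $\mathsf{Alg}(\vec x)$ denotes the value obtained, and the regret is $\sup_{\vec x}\big(x_1-\mathbb{E}[\mathsf{Alg}(\vec x)]\big)$, the supremum over all $n$ and all such value vectors. *)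

theory Defs
  imports "HOL-Probability.Probability"
begin

text \<open>
  A value vector \<open>x\<^sub>1 \<ge> \<dots> \<ge> x\<^sub>n\<close> is a function on \<^typ>\<open>nat\<close> of which only the
  arguments in \<open>{1..n}\<close> matter; likewise for vectors of arrival times.
\<close>

definition value_vectors :: "nat \<Rightarrow> (nat \<Rightarrow> real) set" where
  "value_vectors n = {x. x \<in> {1..n} \<rightarrow> {0..1} \<and> antimono_on {1..n} x}"

text \<open>
  The uniform distribution is taken with underlying space \<open>{0..1}\<close>, since a threshold
  function need not be measurable outside of it.
\<close>

definition arrival_times :: "nat \<Rightarrow> (nat \<Rightarrow> real) measure" where
  "arrival_times n = (\<Pi>\<^sub>M i\<in>{1..n}. restrict_space lborel {0..1})"

text \<open>
  An algorithm is given by the value \<open>A n x t\<close> that it obtains on the \<open>n\<close> values \<open>x\<close>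
  when they arrive at times \<open>t\<close>.
\<close>

definition expected_value ::
  "(nat \<Rightarrow> (nat \<Rightarrow> real) \<Rightarrow> (nat \<Rightarrow> real) \<Rightarrow> real) \<Rightarrow> nat \<Rightarrow> (nat \<Rightarrow> real) \<Rightarrow> real" where
  "expected_value A n x = (\<integral>t. A n x t \<partial>arrival_times n)"

definition regret :: "(nat \<Rightarrow> (nat \<Rightarrow> real) \<Rightarrow> (nat \<Rightarrow> real) \<Rightarrow> real) \<Rightarrow> real" where
  "regret A = Sup {x 1 - expected_value A n x | n x. 1 \<le> n \<and> x \<in> value_vectors n}"

text \<open>
  \<^const>\<open>arg_min_on\<close> selects the earliest acceptable arrival. How it resolves ties among
  arrival times is immaterial, as they have probability zero.
\<close>

definition pricing_curve ::
  "(real \<Rightarrow> real) \<Rightarrow> nat \<Rightarrow> (nat \<Rightarrow> real) \<Rightarrow> (nat \<Rightarrow> real) \<Rightarrow> real" where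
  "pricing_curve f n x t =
    (let S = {i \<in> {1..n}. f (t i) \<le> x i} in if S = {} then 0 else x (arg_min_on t S))"

lemma pricing_curve_nonneg:
  assumes "x \<in> value_vectors n"
  shows "0 \<le> pricing_curve f n x t"
proof (cases "{i \<in> {1..n}. f (t i) \<le> x i} = {}")
  case True
  then show ?thesis by (simp add: pricing_curve_def Let_def)
next
  case False
  let ?S = "{i \<in> {1..n}. f (t i) \<le> x i}"
  have "arg_min_on t ?S \<in> ?S"
    by (rule arg_min_if_finite(1)) (use False in auto)
  then have "0 \<le> x (arg_min_on t ?S)"
    using assms by (auto simp: value_vectors_def Pi_iff)
  then show ?thesis
    using False unfolding pricing_curve_def Let_def by (subst if_not_P) auto
qed

text \<open>
  The supremum in \<^const>\<open>regret\<close> is therefore a genuine one, not the default value of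
  \<^const>\<open>Sup\<close> on an unbounded set of reals.
\<close>

lemma bdd_above_regret_pricing_curve:
  "bdd_above {x 1 - expected_value (pricing_curve f) n x | n x. 1 \<le> n \<and> x \<in> value_vectors n}"
proof (rule bdd_aboveI[of _ 1], clarify)
  fix n :: nat and x
  assume n: "1 \<le> n" and x: "x \<in> value_vectors n"
  have "0 \<le> expected_value (pricing_curve f) n x"
    unfolding expected_value_def
    by (rule Bochner_Integration.integral_nonneg) (simp add: pricing_curve_nonneg[OF x])
  moreover have "x 1 \<le> 1"
    using n x by (auto simp: value_vectors_def Pi_iff)
  ultimately show "x 1 - expected_value (pricing_curve f) n x \<le> 1"
    by linarith
qed

end

theory Submission
  imports Defs
begin

text \<open>
  Let \<open>F\<close> be the measure of the times at which the threshold is at most \<open>1/2\<close>. If \<open>F \<le> 1/2\<close>,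
  the single value \<open>1/2\<close> is missed with probability at least \<open>1/2\<close>. If \<open>F > 1/2\<close>, then a set of
  positive measure of these times lies before time \<open>1/2\<close>; among many copies of \<open>1/2\<close>, one then
  almost surely arrives in that set, so whenever the additional value \<open>1\<close> arrives after time
  \<open>1/2\<close> the curve has already settled for \<open>1/2\<close>.
\<close>

abbreviation uniform_time :: "real measure" where
  "uniform_time \<equiv> restrict_space lborel {0..1}"

lemma prob_space_uniform_time: "prob_space uniform_time"
  by (rule prob_spaceI) (simp add: emeasure_restrict_space space_restrict_space)

interpretation uniform_time: prob_space uniform_time
  by (rule prob_space_uniform_time)

lemma prob_space_arrival_times: "prob_space (arrival_times n)"
  unfolding arrival_times_def by (rule prob_space_PiM) (rule prob_space_uniform_time)

text \<open>Independence of the arrival times enters only in this form: every event measured below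
  is a box or a difference of two boxes.\<close>

lemma measure_arrival_times_PiE:
  assumes "\<And>i. i \<in> {1..n} \<Longrightarrow> A i \<in> sets uniform_time"
  shows "measure (arrival_times n) (Pi\<^sub>E {1..n} A) = (\<Prod>i\<in>{1..n}. measure uniform_time (A i))"
proof -
  interpret finite_product_prob_space "\<lambda>_. uniform_time" "{1..n}"
    by unfold_locales simp
  show ?thesis
    unfolding arrival_times_def by (rule finite_measure_PiM_emb) (rule assms)
qed

lemma late_in_sets: "{1/2..1} \<in> sets uniform_time"
  by (auto simp: sets_restrict_space intro!: image_eqI[of _ _ "{1/2..1}"])

lemma measure_uniform_time_late: "measure uniform_time {1/2..1} = 1/2"
  by (simp add: measure_restrict_space)

lemma regret_pricing_curve_ge:
  assumes "1 \<le> n" "x \<in> value_vectors n"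
  shows "x 1 - expected_value (pricing_curve f) n x \<le> regret (pricing_curve f)"
  unfolding regret_def
  by (rule cSup_upper[OF _ bdd_above_regret_pricing_curve]) (use assms in blast)

lemma pricing_curve_le_1:
  assumes "x \<in> value_vectors n"
  shows "pricing_curve f n x t \<le> 1"
proof (cases "{i \<in> {1..n}. f (t i) \<le> x i} = {}")
  case True
  then show ?thesis by (simp add: pricing_curve_def Let_def)
next
  case False
  let ?S = "{i \<in> {1..n}. f (t i) \<le> x i}"
  have "arg_min_on t ?S \<in> ?S"
    by (rule arg_min_if_finite(1)) (use False in auto)
  then have "x (arg_min_on t ?S) \<le> 1"
    using assms by (auto simp: value_vectors_def Pi_iff)
  then show ?thesis
    using False unfolding pricing_curve_def Let_def by (subst if_not_P) auto
qed

text \<open>On the instance with the single value \<open>c\<close>, something is obtained only when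
  the arrival time falls where the threshold is at most \<open>c\<close>. The choice
  \<open>c = 1/2\<close> settles thresholds that are mostly above \<open>1/2\<close>.\<close>

lemma regret_ge_single_value:
  assumes c: "c \<in> {0..1}" and G: "{s \<in> {0..1}. f s \<le> c} \<in> sets uniform_time"
  shows "c * (1 - measure uniform_time {s \<in> {0..1}. f s \<le> c}) \<le> regret (pricing_curve f)"
proof -
  let ?G = "{s \<in> {0..1}. f s \<le> c}" and ?M = "arrival_times 1"
  let ?E = "Pi\<^sub>E {1..1::nat} (\<lambda>_. ?G)"
  interpret M: prob_space ?M by (rule prob_space_arrival_times)
  have E: "?E \<in> sets ?M"
    unfolding arrival_times_def by (rule sets_PiM_I_finite) (use G in auto)
  have "expected_value (pricing_curve f) 1 (\<lambda>_. c) \<le> (\<integral>t. c * indicator ?E t \<partial>?M)"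
    unfolding expected_value_def
  \<comment> \<open>The rule asks for integrability of the majorant alone; nonnegativity of the
    majorant covers an integrand that is not integrable, whose integral is 0 by default.\<close>
  proof (rule integral_mono')
    show "integrable ?M (\<lambda>t. c * indicator ?E t)"
      using E by (intro integrable_mult_right M.integrable_const_bound[where B = 1]) auto
    fix t assume t: "t \<in> space ?M"
    show "pricing_curve f 1 (\<lambda>_. c) t \<le> c * indicator ?E t"
    proof (cases "f (t 1) \<le> c")
      case True
      then have "t \<in> ?E"
        using t by (auto simp: arrival_times_def space_PiM PiE_iff space_restrict_space)
      then show ?thesis using c by (simp add: pricing_curve_def Let_def)
    next
      case False
      then have none: "{i \<in> {1..1}. f (t i) \<le> c} = {}" by auto
      show ?thesis
        unfolding pricing_curve_def Let_def none using c by simp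
    qed
    show "0 \<le> c * indicator ?E t" using c by simp
  qed
  also have "\<dots> = c * measure uniform_time ?G"
    using E measure_arrival_times_PiE[of 1 "\<lambda>_. ?G"] G by simp
  finally have "expected_value (pricing_curve f) 1 (\<lambda>_. c) \<le> c * measure uniform_time ?G" .
  moreover have "(\<lambda>_. c) \<in> value_vectors 1"
    using c by (auto simp: value_vectors_def monotone_on_def)
  ultimately show ?thesis
    using regret_pricing_curve_ge[of 1 "\<lambda>_. c" f] by (simp add: algebra_simps)
qed

text \<open>Independent of the number of values, so that the number of copies of \<open>1/2\<close>
  can later tend to infinity.\<close>

definition one_and_halves :: "nat \<Rightarrow> real" where
  "one_and_halves i = (if i = 1 then 1 else 1/2)"

lemma one_and_halves_value_vector: "one_and_halves \<in> value_vectors n"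
  by (auto simp: value_vectors_def one_and_halves_def monotone_on_def)

text \<open>The earliest acceptable arrival is no later than that of \<open>i\<close>, hence
  strictly before that of the value 1, and all other values are \<open>1/2\<close>.\<close>

lemma pricing_curve_one_and_halves_le:
  assumes i: "i \<in> {1..n}" "f (t i) \<le> 1/2" "t i < t 1"
  shows "pricing_curve f n one_and_halves t \<le> 1/2"
proof -
  let ?S = "{i \<in> {1..n}. f (t i) \<le> one_and_halves i}"
  have iS: "i \<in> ?S" using i by (auto simp: one_and_halves_def)
  then have "t (arg_min_on t ?S) \<le> t i"
    by (intro arg_min_least) auto
  then have "arg_min_on t ?S \<noteq> 1" using i by auto
  then have "one_and_halves (arg_min_on t ?S) \<le> 1/2"
    by (simp add: one_and_halves_def)
  then show ?thesis
    using iS unfolding pricing_curve_def Let_def by (subst if_not_P) auto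
qed

text \<open>The instance consists of the value 1 and \<open>n\<close> copies of \<open>1/2\<close>.
  With probability \<open>1/2\<close> the value 1 arrives late, and independently some copy hits
  \<open>A\<close> with probability \<open>1 - (1 - measure uniform_time A) ^ n\<close>; when both
  happen, at least \<open>1/2\<close> is lost.\<close>

lemma regret_ge_early_acceptance:
  assumes A: "A \<in> sets uniform_time" and early: "A \<subseteq> {s. s < 1/2 \<and> f s \<le> 1/2}"
  shows "1/4 * (1 - (1 - measure uniform_time A) ^ n) \<le> regret (pricing_curve f)"
proof -
  let ?x = one_and_halves and ?M = "arrival_times (Suc n)"
  define B where "B i = (if i = 1 then {1/2..1} else {0..1::real})" for i :: nat
  define C where "C i = (if i = 1 then {1/2..1} else {0..1::real} - A)" for i :: nat
  \<comment> \<open>The box of \<open>B\<close> says that the value 1 arrives late, the box of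
    \<open>C\<close> that moreover every copy misses \<open>A\<close>. So \<open>E\<close> is the
    event that the value 1 is late and some copy arrives in \<open>A\<close>.\<close>
  define E where "E = Pi\<^sub>E {1..Suc n} B - Pi\<^sub>E {1..Suc n} C"
  interpret M: prob_space ?M by (rule prob_space_arrival_times)
  \<comment> \<open>Splits the factor of the value 1 off the products; the \<open>n\<close>
    remaining indices yield the \<open>n\<close>-th power.\<close>
  have I: "{1..Suc n} = insert 1 {2..Suc n}" by auto
  have top: "{0..1} \<in> sets uniform_time"
    using sets.top[of uniform_time] by (simp add: space_restrict_space)
  have B: "B i \<in> sets uniform_time" and C: "C i \<in> sets uniform_time" for i
    using top late_in_sets A by (auto simp: B_def C_def)
  have BM: "Pi\<^sub>E {1..Suc n} B \<in> sets ?M" and CM: "Pi\<^sub>E {1..Suc n} C \<in> sets ?M"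
    unfolding arrival_times_def by (rule sets_PiM_I_finite; use B C in auto)+
  have E: "E \<in> sets ?M" unfolding E_def using BM CM by auto
  have unit: "measure uniform_time {0..1} = 1"
    using uniform_time.prob_space by (simp add: space_restrict_space)
  have compl: "measure uniform_time ({0..1} - A) = 1 - measure uniform_time A"
    using uniform_time.prob_compl[OF A] by (simp add: space_restrict_space)
  have "measure ?M (Pi\<^sub>E {1..Suc n} B) = 1/2"
    unfolding measure_arrival_times_PiE[OF B] unfolding I
    by (simp add: B_def measure_uniform_time_late unit)
  moreover have "measure ?M (Pi\<^sub>E {1..Suc n} C) = 1/2 * (1 - measure uniform_time A) ^ n"
    unfolding measure_arrival_times_PiE[OF C] unfolding I
    by (simp add: C_def measure_uniform_time_late compl)
  moreover have "Pi\<^sub>E {1..Suc n} C \<subseteq> Pi\<^sub>E {1..Suc n} B"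
    by (rule PiE_mono) (auto simp: B_def C_def)
  ultimately have probE: "measure ?M E = 1/2 * (1 - (1 - measure uniform_time A) ^ n)"
    unfolding E_def using BM CM by (simp add: M.finite_measure_Diff algebra_simps)
  have int: "integrable ?M (indicator E :: _ \<Rightarrow> real)"
    using E by (intro M.integrable_const_bound[where B = 1]) auto
  have "expected_value (pricing_curve f) (Suc n) ?x \<le> (\<integral>t. 1 - 1/2 * indicator E t \<partial>?M)"
    unfolding expected_value_def
  proof (rule integral_mono')
    show "integrable ?M (\<lambda>t. 1 - 1/2 * indicator E t :: real)"
      using int by simp
    fix t assume "t \<in> space ?M"
    show "pricing_curve f (Suc n) ?x t \<le> 1 - 1/2 * indicator E t"
    proof (cases "t \<in> E")
      case True
      then have tB: "t \<in> Pi\<^sub>E {1..Suc n} B" and "t \<notin> Pi\<^sub>E {1..Suc n} C"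
        by (auto simp: E_def)
      \<comment> \<open>Since \<open>B 1 = C 1\<close>, this index is not 1: it is a copy of
        \<open>1/2\<close> arriving in \<open>A\<close>, strictly before time
        \<open>1/2\<close>.\<close>
      then obtain i where i: "i \<in> {1..Suc n}" "t i \<notin> C i"
        by (auto simp: PiE_iff)
      have "t i \<in> B i" "t 1 \<in> B 1" using tB i by (auto simp: PiE_iff)
      then have "t i \<in> A" "1/2 \<le> t 1"
        using i by (auto simp: B_def C_def split: if_splits)
      then have "pricing_curve f (Suc n) ?x t \<le> 1/2"
        using i early by (intro pricing_curve_one_and_halves_le[of i]) auto
      then show ?thesis using True by simp
    next
      case False
      then show ?thesis
        using pricing_curve_le_1[OF one_and_halves_value_vector] by simp
    qed
    show "0 \<le> 1 - 1/2 * (indicator E t :: real)" by (simp add: indicator_def)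
  qed
  also have "\<dots> = 1 - 1/2 * measure ?M E"
    using int E by (simp add: M.prob_space)
  finally have "1/2 * measure ?M E \<le> ?x 1 - expected_value (pricing_curve f) (Suc n) ?x"
    by (simp add: one_and_halves_def)
  also have "\<dots> \<le> regret (pricing_curve f)"
    by (rule regret_pricing_curve_ge) (simp_all add: one_and_halves_value_vector)
  finally show ?thesis unfolding probE by simp
qed

theorem theorem3p2:
  fixes f :: "real \<Rightarrow> real"
  assumes "f \<in> {0..1} \<rightarrow> {0..1}"
    and "f \<in> borel_measurable (restrict_space borel {0..1})"
  shows "regret (pricing_curve f) \<ge> 1/4"
proof -
  define G where "G = {s \<in> {0..1}. f s \<le> 1/2}"
  have "{s \<in> space (restrict_space borel {0..1}). f s \<le> 1/2} \<in> sets (restrict_space borel {0..1})"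
    using assms(2) by measurable
  then have G: "G \<in> sets uniform_time"
    by (simp add: G_def space_restrict_space sets_restrict_space)
  show ?thesis
  proof (cases "measure uniform_time G \<le> 1/2")
    case True
    moreover have "1/2 * (1 - measure uniform_time G) \<le> regret (pricing_curve f)"
      using regret_ge_single_value[of "1/2" f] G unfolding G_def by simp
    ultimately show ?thesis by simp
  next
    case False
    define A where "A = G - {1/2..1}"
    have A: "A \<in> sets uniform_time" unfolding A_def using G late_in_sets by auto
    \<comment> \<open>The late half has measure only \<open>1/2\<close>, less than that of
      \<open>G\<close>, so \<open>A\<close> cannot be null.\<close>
    have "measure uniform_time G \<le> measure uniform_time (A \<union> {1/2..1})"
      using sets.Un[OF A late_in_sets] by (intro uniform_time.finite_measure_mono) (auto simp: A_def)
    also have "\<dots> \<le> measure uniform_time A + 1/2"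
      using measure_Un_le[OF A late_in_sets]
      by (simp add: measure_uniform_time_late)
    finally have "0 < measure uniform_time A" using False by simp
    then have "(\<lambda>n. (1 - measure uniform_time A) ^ n) \<longlonglongrightarrow> 0"
      using uniform_time.prob_le_1[of A] by (intro LIMSEQ_realpow_zero) auto
    then have "(\<lambda>n. 1/4 * (1 - (1 - measure uniform_time A) ^ n)) \<longlonglongrightarrow> 1/4 * (1 - 0)"
      by (intro tendsto_mult tendsto_diff tendsto_const)
    moreover have "1/4 * (1 - (1 - measure uniform_time A) ^ n) \<le> regret (pricing_curve f)" for n
      using A by (rule regret_ge_early_acceptance) (auto simp: A_def G_def)
    \<comment> \<open>The regret does not depend on \<open>n\<close>, so it also bounds the limit of
      the lower bounds, even if no single instance attains \<open>1/4\<close>.\<close>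
    ultimately have "1/4 * (1 - 0) \<le> regret (pricing_curve f)"
      by (intro LIMSEQ_le_const2) auto
    then show ?thesis by simp
  qed
qed

end
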